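(* Let $(x_h)_{h\in\mathbb{Z}}$ be a strictly increasing sequence of real numbers. Let $F:\mathbb{R}\rightarrow\mathbb{R}$ be a non-negative function such that: (i) $F$ is right-continuous and assigns to intervals $]a,b]$, $a<b$, a non-negative length $\Delta F(a,b)=F(b)-F(a)\geq 0$; (ii) $F$ is continuous on the intervals $]x_{h-1},x_h[$, $h\in\mathbb{Z}$; and (iii) $F$ is discontinuous at the $x_h$'s. Let $p_h$ denote the jump of $F$ at $x_h$, $h\in\mathbb{Z}$. Then: (a) for any measurable function $f:\mathbb{R}\rightarrow\overline{\mathbb{R}}$, of constant sign, almost-surely continuous on each $]x_{h-1},x_h[$ with respect to the Lebesgue measure, which ensures that $$\int 1_{]x_{h-1},x_h[}(x)f(x)\,dF(x)\in\mathbb{R},$$ the Lebesgue-Stieltjes integral of $f$ with respect to $F$ exists in $\overline{\mathbb{R}}$ and is given by $$\int f(x)\,dF(x)=\sum_{h\in\mathbb{Z}}\left(p_hf(x_h)+\int 1_{]x_{h-1},x_h[}(x)f(x)\,dF(x)\right);$$ (b) for any measurable function $f:\mathbb{R}\rightarrow\overline{\mathbb{R}}$, almost-surely continuous on each $]x_{h-1},x_h[$ with respect to the Lebesgue measure, which ensures that $$\int 1_{]x_{h-1},x_h[}(x)f(x)\,dF(x)\in\mathbb{R},$$ and such that $$0\leq\sum_{h\in\mathbb{Z}}\left(p_hf^{+}(x_h)+\int 1_{]x_{h-1},x_h[}(x)f^{+}(x)\,dF(x)\right)<+\infty$$ or $$0\leq\sum_{h\in\mathbb{Z}}\left(p_hf^{-}(x_h)+\int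 1_{]x_{h-1},x_h[}(x)f^{-}(x)\,dF(x)\right)<+\infty,$$ the Lebesgue-Stieltjes integral of $f$ with respect to $F$ exists in $\overline{\mathbb{R}}$ and is given by the same formula $$\int f(x)\,dF(x)=\sum_{h\in\mathbb{Z}}\left(p_hf(x_h)+\int 1_{]x_{h-1},x_h[}(x)f(x)\,dF(x)\right).$$
   Context: Notation: $\overline{\mathbb{R}}=\mathbb{R}\cup\{-\infty,+\infty\}$; $]a,b[$ and $]a,b]$ denote open and left-open right-closed intervals; $1_A$ is the indicator function of $A$; $f^{+}=\max(f,0)$ and $f^{-}=\max(-f,0)$ are the positive and negative parts of $f$. The jump of $F$ at $x_h$ is $p_h=F(x_h)-F(x_h-0)$, where $F(x_h-0)$ is the left-hand limit of $F$ at $x_h$. The sequence $(x_h)$ may be bounded and/or finite, the notation being adapted accordingly. "Almost-surely continuous with respect to the Lebesgue measure" on an interval means continuous at Lebesgue-almost every point of it. The Lebesgue-Stieltjes integral $\int f\,dF$ is the integral of $f$ with respect to the Lebesgue-Stieltjes measure $\lambda_F$, the measure determined by $\lambda_F(]a,b])=F(b)-F(a)$ for $a<b$.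
   Formalization: If the points x_h accumulate at a finite limit, the displayed formula fails; there the integrals of f over the remaining closed half-lines are added to the sums, and the continuity and finiteness hypotheses are also imposed on those half-lines. *)

theory Defs
  imports "HOL-Analysis.Analysis"
begin

section \<open>Integrals of extended real valued functions\<close>

definition pos_part :: "('a \<Rightarrow> ereal) \<Rightarrow> 'a \<Rightarrow> ereal" where
  "pos_part f = (\<lambda>t. max (f t) 0)"

definition neg_part :: "('a \<Rightarrow> ereal) \<Rightarrow> 'a \<Rightarrow> ereal" where
  "neg_part f = (\<lambda>t. max (- f t) 0)"

text \<open>The integral exists in the extended reals unless both parts have infinite integral; the
  Bochner integral of the library does not cover extended real valued integrands.\<close>

definition integral_exists :: "'a measure \<Rightarrow> ('a \<Rightarrow> ereal) \<Rightarrow> bool" where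
  "integral_exists M f \<longleftrightarrow> f \<in> borel_measurable M \<and>
     ((\<integral>\<^sup>+ t. e2ennreal (pos_part f t) \<partial>M) < \<infinity> \<or> (\<integral>\<^sup>+ t. e2ennreal (neg_part f t) \<partial>M) < \<infinity>)"

definition ext_integral :: "'a measure \<Rightarrow> ('a \<Rightarrow> ereal) \<Rightarrow> ereal" where
  "ext_integral M f =
     enn2ereal (\<integral>\<^sup>+ t. e2ennreal (pos_part f t) \<partial>M) - enn2ereal (\<integral>\<^sup>+ t. e2ennreal (neg_part f t) \<partial>M)"

abbreviation LS_exists :: "(real \<Rightarrow> real) \<Rightarrow> (real \<Rightarrow> ereal) \<Rightarrow> bool" where
  "LS_exists F f \<equiv> integral_exists (interval_measure F) f"

abbreviation LS_integral :: "(real \<Rightarrow> real) \<Rightarrow> (real \<Rightarrow> ereal) \<Rightarrow> ereal" where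
  "LS_integral F f \<equiv> ext_integral (interval_measure F) f"

definition LS_integral_on :: "(real \<Rightarrow> real) \<Rightarrow> real set \<Rightarrow> (real \<Rightarrow> ereal) \<Rightarrow> ereal" where
  "LS_integral_on F A f = LS_integral F (\<lambda>t. indicator A t * f t)"

definition LS_finite_on :: "(real \<Rightarrow> real) \<Rightarrow> real set \<Rightarrow> (real \<Rightarrow> ereal) \<Rightarrow> bool" where
  "LS_finite_on F A f \<longleftrightarrow>
     LS_exists F (\<lambda>t. indicator A t * f t) \<and> \<bar>LS_integral_on F A f\<bar> \<noteq> \<infinity>"

definition jump :: "(real \<Rightarrow> real) \<Rightarrow> real \<Rightarrow> real" where
  "jump F t = F t - Lim (at_left t) F"


section \<open>Increasing sequences of points of the real line\<close>

text \<open>A strictly increasing sequence of reals that may be finite or infinite on one or both sides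
  is encoded as a function on all integers, padded with \<open>-\<infinity>\<close> on the left and \<open>\<infinity>\<close> on the right:
  the terms of the sequence are the finite values. With this convention the intervals
  \<open>]x (h - 1), x h[\<close> of a finite sequence include the two unbounded end intervals.\<close>

definition point_sequence :: "(int \<Rightarrow> ereal) \<Rightarrow> bool" where
  "point_sequence x \<longleftrightarrow> (\<forall>h. x h < x (h + 1) \<or> (x h = x (h + 1) \<and> \<bar>x h\<bar> = \<infinity>))"

definition gap :: "(int \<Rightarrow> ereal) \<Rightarrow> int \<Rightarrow> real set" where
  "gap x h = {t. x (h - 1) < ereal t \<and> ereal t < x h}"

text \<open>If infinitely many points accumulate at a finite limit, the points and the gaps do not
  exhaust the line; what remains is one of the following two closed half-lines. Both are empty if
  the sequence is unbounded or ends on the respective side (see below).\<close>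

definition lower_tail :: "(int \<Rightarrow> ereal) \<Rightarrow> real set" where
  "lower_tail x = {t. ereal t \<le> (INF h. x h)}"

definition upper_tail :: "(int \<Rightarrow> ereal) \<Rightarrow> real set" where
  "upper_tail x = {t. (SUP h. x h) \<le> ereal t}"

definition cells :: "(int \<Rightarrow> ereal) \<Rightarrow> real set set" where
  "cells x = range (gap x) \<union> {lower_tail x, upper_tail x}"

text \<open>The padding values \<open>-\<infinity>\<close> and \<open>\<infinity>\<close> are not points, so they contribute no point mass.\<close>

definition cell_term :: "(int \<Rightarrow> ereal) \<Rightarrow> (real \<Rightarrow> real) \<Rightarrow> (real \<Rightarrow> ereal) \<Rightarrow> int \<Rightarrow> ereal" where
  "cell_term x F f h =
     (if \<bar>x h\<bar> = \<infinity> then 0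
      else ereal (jump F (real_of_ereal (x h))) * f (real_of_ereal (x h)))
     + LS_integral_on F (gap x h) f"

definition cell_sum :: "(int \<Rightarrow> ereal) \<Rightarrow> (real \<Rightarrow> real) \<Rightarrow> (real \<Rightarrow> ereal) \<Rightarrow> ereal" where
  "cell_sum x F f =
     (\<Sum>\<^sub>\<infinity>h. cell_term x F f h)
     + LS_integral_on F (lower_tail x) f + LS_integral_on F (upper_tail x) f"


section \<open>The encoding in the standard cases\<close>

lemma LS_integral_on_empty [simp]: "LS_integral_on F {} f = 0"
proof -
  have z: "e2ennreal 0 = 0"
    by (metis e2ennreal_enn2ereal zero_ennreal.rep_eq)
  show ?thesis
    by (simp add: LS_integral_on_def ext_integral_def pos_part_def neg_part_def z zero_ennreal.rep_eq)
qed

lemma lower_tail_empty: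
  assumes "\<And>t. \<exists>h. x h < ereal t"
  shows "lower_tail x = {}"
  using assms by (auto simp: lower_tail_def le_INF_iff) (meson not_le)

lemma upper_tail_empty:
  assumes "\<And>t. \<exists>h. x h > ereal t"
  shows "upper_tail x = {}"
  using assms by (auto simp: upper_tail_def SUP_le_iff) (meson not_le)

text \<open>A sequence of reals indexed by the integers and unbounded on both sides.\<close>

lemma point_sequence_real:
  fixes y :: "int \<Rightarrow> real"
  assumes "strict_mono y"
  shows "point_sequence (\<lambda>h. ereal (y h))"
  using assms by (simp add: point_sequence_def strict_mono_def)

lemma gap_real: "gap (\<lambda>h. ereal (y h)) h = {y (h - 1)<..<y h}"
  by (auto simp: gap_def)

lemma cell_sum_real:
  fixes y :: "int \<Rightarrow> real"
  assumes "\<And>t. \<exists>h. y h < t" and "\<And>t. \<exists>h. y h > t"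
  shows "cell_sum (\<lambda>h. ereal (y h)) F f =
    (\<Sum>\<^sub>\<infinity>h. ereal (jump F (y h)) * f (y h)
           + LS_integral F (\<lambda>t. indicator {y (h - 1)<..<y h} t * f t))"
  using lower_tail_empty[of "\<lambda>h. ereal (y h)"] upper_tail_empty[of "\<lambda>h. ereal (y h)"] assms
  by (simp add: cell_sum_def cell_term_def gap_real LS_integral_on_def[of F "{_<..<_}"])

text \<open>A finite sequence \<open>y 1 < \<dots> < y n\<close>.\<close>

lemma finite_point_sequence:
  fixes y :: "int \<Rightarrow> real" and n :: int
  defines "x \<equiv> (\<lambda>h. if h < 1 then -\<infinity> else if h \<le> n then ereal (y h) else \<infinity>)"
  assumes "\<And>h. 1 \<le> h \<Longrightarrow> h < n \<Longrightarrow> y h < y (h + 1)"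
  shows "point_sequence x" and "lower_tail x = {}" and "upper_tail x = {}"
proof -
  show "point_sequence x"
    using assms(2) by (auto simp: point_sequence_def x_def)
  show "lower_tail x = {}"
    by (rule lower_tail_empty, rule exI[of _ 0]) (simp add: x_def)
  show "upper_tail x = {}"
    by (rule upper_tail_empty, rule exI[of _ "\<bar>n\<bar> + 1"]) (auto simp: x_def)
qed

end

theory Submission
  imports Defs
begin

text \<open>Why the formula holds: the half-open blocks \<open>]x (h - 1), x h]\<close>, each a gap together with its
  right end point, form with the two tails a countable measurable partition of the line, and the
  extended real integral is countably additive over such a partition as soon as it exists.

  Additivity is reduced to measures: with \<open>M\<close> the Lebesgue-Stieltjes measure, the integral of
  \<open>f\<close> over a set \<open>A\<close> is \<open>\<mu>(A) - \<nu>(A)\<close>, where \<open>\<mu>\<close> and \<open>\<nu>\<close> have the positive and the negative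
  part of \<open>f\<close> as densities with respect to \<open>M\<close> (\<open>ext_integral_indicator\<close>). Both measures are
  countably additive, and the integral of \<open>f\<close> exists exactly if one of them is finite, so that the
  difference of the two sums converges unconditionally to the difference of the totals
  (\<open>has_sum_ext_integral_UN\<close>). Inside a block, the end point contributes \<open>f (x h)\<close> times
  its mass, which is the jump of \<open>F\<close> because \<open>M {s<..a} = F a - F s\<close>
  (\<open>emeasure_interval_measure_singleton\<close>). This gives the formula for every \<open>f\<close> whose integral
  exists (\<open>LS_integral_eq_cell_sum\<close>).

  A function of constant sign has an integral, which settles (a). For (b), the same formula
  applied to the nonnegative functions \<open>f\<^sup>+\<close> and \<open>f\<^sup>-\<close> identifies the two sums of the hypothesis
  with the integrals of these parts, so one of these is finite and the integral of \<open>f\<close>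
  exists.\<close>

section \<open>Additivity of the extended real integral over sets\<close>

text \<open>Since \<^const>\<open>e2ennreal\<close> sends negative numbers to 0, the density is the positive part of
  \<open>f\<close>; the negative part is obtained from \<open>- f\<close>.\<close>

definition pos_density :: "'a measure \<Rightarrow> ('a \<Rightarrow> ereal) \<Rightarrow> 'a measure" where
  "pos_density M f = density M (\<lambda>t. e2ennreal (f t))"

lemma sets_pos_density [simp, measurable_cong]: "sets (pos_density M f) = sets M"
  by (simp add: pos_density_def)

lemma ext_integral_indicator:
  fixes f :: "'a \<Rightarrow> ereal"
  assumes f [measurable]: "f \<in> borel_measurable M" and A [measurable]: "A \<in> sets M"
  shows "ext_integral M (\<lambda>t. indicator A t * f t) =
    enn2ereal (emeasure (pos_density M f) A) - enn2ereal (emeasure (pos_density M (\<lambda>t. - f t)) A)"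
proof -
  have restrict: "(\<integral>\<^sup>+ t. e2ennreal (max (g t) 0) \<partial>M) = emeasure (pos_density M f') A"
    if g: "\<And>t. g t = indicator A t * f' t" and [measurable]: "f' \<in> borel_measurable M"
    for g f' :: "'a \<Rightarrow> ereal"
  proof -
    have "e2ennreal (max (g t) 0) = e2ennreal (f' t) * indicator A t" for t
      by (cases "0 \<le> f' t")
        (auto simp: g indicator_def max_def e2ennreal_neg simp flip: zero_ereal_def)
    then show ?thesis
      by (simp add: pos_density_def emeasure_density)
  qed
  show ?thesis
    unfolding ext_integral_def pos_part_def neg_part_def
    by (subst restrict[of _ f] restrict[of _ "\<lambda>t. - f t"], simp_all)+
qed

lemma ext_integral_eq_densities:
  fixes f :: "'a \<Rightarrow> ereal"
  assumes [measurable]: "f \<in> borel_measurable M"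
  shows "ext_integral M f = enn2ereal (emeasure (pos_density M f) (space M)) -
    enn2ereal (emeasure (pos_density M (\<lambda>t. - f t)) (space M))"
    and "integral_exists M f \<longleftrightarrow> emeasure (pos_density M f) (space M) < \<infinity> \<or>
      emeasure (pos_density M (\<lambda>t. - f t)) (space M) < \<infinity>"
proof -
  have "(\<integral>\<^sup>+ t. e2ennreal (max (g t) 0) \<partial>M) = emeasure (pos_density M g) (space M)"
    if [measurable]: "g \<in> borel_measurable M" for g :: "'a \<Rightarrow> ereal"
  proof -
    have "e2ennreal (max a 0) = e2ennreal a" for a
      by (cases "0 \<le> a") (auto simp: max_def e2ennreal_neg)
    then show ?thesis
      by (simp add: pos_density_def emeasure_density cong: nn_integral_cong)
  qed
  then show "ext_integral M f = enn2ereal (emeasure (pos_density M f) (space M)) -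
      enn2ereal (emeasure (pos_density M (\<lambda>t. - f t)) (space M))"
    and "integral_exists M f \<longleftrightarrow> emeasure (pos_density M f) (space M) < \<infinity> \<or>
      emeasure (pos_density M (\<lambda>t. - f t)) (space M) < \<infinity>"
    by (simp_all add: ext_integral_def integral_exists_def pos_part_def neg_part_def)
qed

text \<open>Because \<open>\<infinity> - \<infinity> = \<infinity>\<close> in \<^typ>\<open>ereal\<close>, both sides are \<open>\<infinity>\<close> as soon as \<open>a\<close> or \<open>b\<close> is. This makes the integral finitely
  additive over sets even where it does not exist.\<close>

lemma enn2ereal_add_diff_add:
  "enn2ereal (a + b) - enn2ereal (c + d) = (enn2ereal a - enn2ereal c) + (enn2ereal b - enn2ereal d)"
  by (cases a; cases b; cases c; cases d)
    (simp_all add: plus_ennreal.rep_eq)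

lemma ext_integral_Un:
  fixes f :: "'a \<Rightarrow> ereal"
  assumes f: "f \<in> borel_measurable M" and AB: "A \<in> sets M" "B \<in> sets M" "A \<inter> B = {}"
  shows "ext_integral M (\<lambda>t. indicator (A \<union> B) t * f t) =
    ext_integral M (\<lambda>t. indicator A t * f t) + ext_integral M (\<lambda>t. indicator B t * f t)"
proof -
  have "emeasure (pos_density M g) (A \<union> B) =
      emeasure (pos_density M g) A + emeasure (pos_density M g) B" for g :: "'a \<Rightarrow> ereal"
    using AB by (intro plus_emeasure[symmetric]) auto
  then show ?thesis
    using AB by (simp add: ext_integral_indicator[OF f] enn2ereal_add_diff_add)
qed

text \<open>Nonnegative unconditional sums are suprema of finite sums, and by continuity from below the
  finite unions along an enumeration of \<open>I\<close> already exhaust the measure of the whole union.\<close>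

lemma has_sum_emeasure_UN:
  assumes sets: "\<And>i. i \<in> I \<Longrightarrow> A i \<in> sets M" and I: "countable I"
    and disj: "disjoint_family_on A I"
  shows "((\<lambda>i. emeasure M (A i)) has_sum emeasure M (\<Union>i\<in>I. A i)) I"
proof -
  let ?\<mu> = "\<lambda>i. emeasure M (A i)"
  have finite_sum: "sum ?\<mu> J = emeasure M (\<Union>i\<in>J. A i)" if "finite J" "J \<subseteq> I" for J
    using that sets disj by (intro sum_emeasure) (auto intro: disjoint_family_on_mono)
  have "emeasure M (\<Union>i\<in>I. A i) = (SUP J\<in>{J. finite J \<and> J \<subseteq> I}. sum ?\<mu> J)"
  proof (rule antisym)
    show "(SUP J\<in>{J. finite J \<and> J \<subseteq> I}. sum ?\<mu> J) \<le> emeasure M (\<Union>i\<in>I. A i)"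
      using sets I by (auto intro!: SUP_least emeasure_mono sets.countable_UN' simp: finite_sum)
    show "emeasure M (\<Union>i\<in>I. A i) \<le> (SUP J\<in>{J. finite J \<and> J \<subseteq> I}. sum ?\<mu> J)"
    proof (cases "I = {}")
      case False
      define J where "J n = from_nat_into I ` {..<n}" for n
      have J: "finite (J n)" "J n \<subseteq> I" for n
        using from_nat_into[OF False] by (auto simp: J_def)
      have "I = (\<Union>n. J n)"
        using range_from_nat_into[OF False I] by (auto simp: J_def)
      then have "emeasure M (\<Union>i\<in>I. A i) = emeasure M (\<Union>n. \<Union>i\<in>J n. A i)"
        by (metis UN_UN_flatten)
      also have "\<dots> = (SUP n. emeasure M (\<Union>i\<in>J n. A i))"
      proof (rule SUP_emeasure_incseq[symmetric])
        show "range (\<lambda>n. \<Union>i\<in>J n. A i) \<subseteq> sets M"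
          using J sets by (auto intro!: sets.finite_UN)
        show "incseq (\<lambda>n. \<Union>i\<in>J n. A i)"
          unfolding J_def by (intro monoI UN_mono image_mono) auto
      qed
      also have "\<dots> \<le> (SUP J\<in>{J. finite J \<and> J \<subseteq> I}. sum ?\<mu> J)"
        using J by (intro SUP_least SUP_upper2[of "J _"]) (auto simp: finite_sum)
      finally show ?thesis .
    qed simp
  qed
  then show ?thesis
    using nonneg_has_sum_complete[of I ?\<mu>] by simp
qed

text \<open>Subtraction is continuous at every pair other than \<open>(\<infinity>, \<infinity>)\<close>, which the finiteness
  assumption excludes.\<close>

lemma has_sum_enn2ereal_diff:
  assumes p: "(p has_sum P) I" and n: "(n has_sum N) I" and finite: "P < \<infinity> \<or> N < \<infinity>"
  shows "((\<lambda>i. enn2ereal (p i) - enn2ereal (n i)) has_sum (enn2ereal P - enn2ereal N)) I"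
proof -
  have "sum (\<lambda>i. enn2ereal (p i) - enn2ereal (n i)) =
      (\<lambda>J. enn2ereal (sum p J) - enn2ereal (sum n J))"
  proof
    show "(\<Sum>i\<in>J. enn2ereal (p i) - enn2ereal (n i)) = enn2ereal (sum p J) - enn2ereal (sum n J)" for J
    by (induction J rule: infinite_finite_induct)
      (simp_all add: enn2ereal_add_diff_add zero_ennreal.rep_eq)
  qed
  moreover have "((\<lambda>J. enn2ereal (sum p J) - enn2ereal (sum n J)) \<longlongrightarrow> enn2ereal P - enn2ereal N)
      (finite_subsets_at_top I)"
    using p n finite unfolding has_sum_def
    by (intro tendsto_diff_ereal_general) (auto simp: less_top)
  ultimately show ?thesis
    by (simp add: has_sum_def)
qed

text \<open>Existence of the integral of \<open>f\<close> over the whole space makes one of the two density measures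
  finite, hence also its value on the union.\<close>

lemma has_sum_ext_integral_UN:
  fixes f :: "'a \<Rightarrow> ereal"
  assumes f: "integral_exists M f" and A: "\<And>i. i \<in> I \<Longrightarrow> A i \<in> sets M"
    and I: "countable I" and disj: "disjoint_family_on A I"
  shows "((\<lambda>i. ext_integral M (\<lambda>t. indicator (A i) t * f t)) has_sum
    ext_integral M (\<lambda>t. indicator (\<Union>i\<in>I. A i) t * f t)) I"
proof -
  have meas: "f \<in> borel_measurable M"
    using f by (simp add: integral_exists_def)
  let ?U = "\<Union>i\<in>I. A i"
  have U: "?U \<in> sets M"
    using A I by auto
  have sum: "((\<lambda>i. emeasure (pos_density M g) (A i)) has_sum emeasure (pos_density M g) ?U) I"
    for g :: "'a \<Rightarrow> ereal"
    using A I disj by (intro has_sum_emeasure_UN) auto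
  have le: "emeasure (pos_density M g) ?U \<le> emeasure (pos_density M g) (space M)"
    for g :: "'a \<Rightarrow> ereal"
    using U sets.sets_into_space by (intro emeasure_mono) auto
  have "emeasure (pos_density M f) ?U < \<infinity> \<or> emeasure (pos_density M (\<lambda>t. - f t)) ?U < \<infinity>"
    using f le unfolding ext_integral_eq_densities(2)[OF meas] by (meson le_less_trans)
  from has_sum_enn2ereal_diff[OF sum sum this] show ?thesis
    unfolding ext_integral_indicator[OF meas U]
    using A by (simp add: ext_integral_indicator[OF meas] cong: has_sum_cong)
qed

section \<open>The mass of a point\<close>

text \<open>The intervals \<open>]s, a]\<close> shrink to \<open>{a}\<close> as \<open>s\<close> increases to \<open>a\<close>, so \<open>F a - F s\<close> tends to
  the mass of \<open>a\<close>. This also shows that the left-hand limit in \<^const>\<open>jump\<close> exists.\<close>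

lemma emeasure_interval_measure_singleton:
  fixes F :: "real \<Rightarrow> real"
  assumes mono: "\<And>s t. s \<le> t \<Longrightarrow> F s \<le> F t" and cont: "\<And>t. continuous (at_right t) F"
  shows "emeasure (interval_measure F) {a} = ennreal (jump F a)" and "0 \<le> jump F a"
proof -
  let ?M = "interval_measure F"
  have Ioc: "emeasure ?M {s<..t} = ennreal (F t - F s)" if "s \<le> t" for s t
    using that mono cont by (rule emeasure_interval_measure_Ioc)
  have "emeasure ?M {a} \<le> emeasure ?M {a - 1<..a}"
    by (intro emeasure_mono) auto
  also have "\<dots> < \<infinity>"
    by (simp add: Ioc)
  finally obtain m where m: "0 \<le> m" "emeasure ?M {a} = ennreal m"
    by (cases "emeasure ?M {a}") auto
  have "((\<lambda>s. ennreal (F a - F s)) \<longlongrightarrow> ennreal m) (at_left a)"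
  proof (rule tendsto_at_left_sequentially)
    show "a - 1 < a" by simp
    fix X :: "nat \<Rightarrow> real"
    assume X: "\<And>n. X n < a" "incseq X" "X \<longlonglongrightarrow> a"
    have "(\<lambda>n. emeasure ?M {X n<..a}) \<longlonglongrightarrow> emeasure ?M (\<Inter>n. {X n<..a})"
    proof (rule Lim_emeasure_decseq)
      show "decseq (\<lambda>n. {X n<..a})"
        using X(2) by (force simp: decseq_def incseq_def)
    qed (use X(1) in \<open>auto simp: Ioc less_imp_le\<close>)
    also have "(\<Inter>n. {X n<..a}) = {a}"
    proof (intro set_eqI iffI)
      fix t assume "t \<in> (\<Inter>n. {X n<..a})"
      then have "X n \<le> t" "t \<le> a" for n
        by (auto intro: less_imp_le)
      then show "t \<in> {a}"
        using LIMSEQ_le_const2[OF X(3), of t] by force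
    qed (use X(1) in auto)
    finally show "(\<lambda>n. ennreal (F a - F (X n))) \<longlonglongrightarrow> ennreal m"
      using X(1) by (simp add: Ioc less_imp_le m(2))
  qed
  moreover have "\<forall>\<^sub>F s in at_left a. 0 \<le> F a - F s"
    using mono by (auto simp: eventually_at_filter less_imp_le)
  ultimately have "((\<lambda>s. F a - F s) \<longlongrightarrow> m) (at_left a)"
    using m(1) by (simp add: tendsto_ennreal_iff)
  then have "((\<lambda>s. F a - (F a - F s)) \<longlongrightarrow> F a - m) (at_left a)"
    by (intro tendsto_intros)
  then have "Lim (at_left a) F = F a - m"
    by (intro tendsto_Lim) auto
  then have "jump F a = m"
    by (simp add: jump_def)
  with m show "emeasure ?M {a} = ennreal (jump F a)" "0 \<le> jump F a"
    by simp_all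
qed

lemma ext_integral_singleton:
  fixes f :: "'a \<Rightarrow> ereal"
  assumes f [measurable]: "f \<in> borel_measurable M" and a [measurable]: "{a} \<in> sets M"
    and m: "emeasure M {a} = ennreal m" "0 \<le> m"
  shows "ext_integral M (\<lambda>t. indicator {a} t * f t) = ereal m * f a"
proof -
  have mass: "enn2ereal (emeasure (pos_density M g) {a}) = ereal m * max (g a) 0"
    if [measurable]: "g \<in> borel_measurable M" for g :: "'a \<Rightarrow> ereal"
  proof -
    have "emeasure (pos_density M g) {a} = (\<integral>\<^sup>+ t. e2ennreal (g a) * indicator {a} t \<partial>M)"
      by (auto simp: pos_density_def emeasure_density indicator_def intro!: nn_integral_cong)
    also have "\<dots> = e2ennreal (g a) * ennreal m"
      by (simp add: nn_integral_cmult_indicator m(1))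
    finally have "enn2ereal (emeasure (pos_density M g) {a}) = enn2ereal (e2ennreal (g a)) * ereal m"
      using m(2) by (simp add: times_ennreal.rep_eq)
    also have "enn2ereal (e2ennreal (g a)) = max (g a) 0"
      by (cases "g a" "0 :: ereal" rule: le_cases) (simp_all add: enn2ereal_e2ennreal e2ennreal_neg max_def zero_ennreal.rep_eq)
    finally show ?thesis
      by (simp only: mult.commute)
  qed
  have "ereal m * max (f a) 0 - ereal m * max (- f a) 0 = ereal m * f a"
    by (cases "f a" "0 :: ereal" rule: le_cases) (simp_all add: max_absorb1 max_absorb2)
  then show ?thesis
    by (simp only: ext_integral_indicator[OF f a] mass f borel_measurable_uminus_ereal)
qed

section \<open>Decomposing the real line along a sequence of points\<close>

text \<open>Attaching each point to the gap on its left yields blocks that tile the line between the two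
  tails also when the sequence is padded with infinite values: a block with right end \<open>\<infinity>\<close> is just
  the gap, and a block with right end \<open>-\<infinity>\<close> is empty.\<close>

definition block :: "(int \<Rightarrow> ereal) \<Rightarrow> int \<Rightarrow> real set" where
  "block x h = {t. x (h - 1) < ereal t \<and> ereal t \<le> x h}"

lemma point_sequence_mono:
  assumes "point_sequence x" "h \<le> k"
  shows "x h \<le> x k"
  using assms(2)
proof (induction k rule: int_ge_induct)
  case (step k)
  have "x k \<le> x (k + 1)"
    using assms(1) by (auto simp: point_sequence_def intro: less_imp_le)
  with step.IH show ?case
    by (rule order_trans)
qed simp

lemma disjoint_family_block:
  assumes x: "point_sequence x"
  shows "disjoint_family (block x)"
proof -
  have "block x h \<inter> block x k = {}" if "h < k" for h k
  proof -
    have "x h \<le> x (k - 1)"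
      using x that by (intro point_sequence_mono) auto
    then show ?thesis
      by (auto simp: block_def)
  qed
  then show ?thesis
    unfolding disjoint_family_on_def by (metis Int_commute linorder_neqE_linordered_idom)
qed

lemma point_sequence_strict:
  assumes x: "point_sequence x" and "\<bar>x h\<bar> \<noteq> \<infinity>"
  shows "x h < x (h + 1)" and "x (h - 1) < x h"
  using x assms(2) unfolding point_sequence_def by (metis, metis diff_add_cancel)

text \<open>Between two indices with \<open>x i < t < x j\<close> the sequence must pass \<open>t\<close>, and the block containing
  \<open>t\<close> ends where it does. Conversely a block cannot meet the upper tail, since a finite supremum
  is not attained: after a real value the sequence increases strictly.\<close>

lemma UN_block:
  assumes x: "point_sequence x"
  shows "(\<Union>h. block x h) = - (lower_tail x \<union> upper_tail x)"
proof (intro set_eqI iffI)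
  fix t assume "t \<in> (\<Union>h. block x h)"
  then obtain h where h: "x (h - 1) < ereal t" "ereal t \<le> x h"
    by (auto simp: block_def)
  have "(INF k. x k) < ereal t"
    using h(1) by (auto simp: INF_less_iff)
  moreover have "ereal t < (SUP k. x k)"
  proof -
    have "\<exists>k. ereal t < x k"
    proof (cases "ereal t < x h")
      case False
      with h(2) have "x h = ereal t" by simp
      with point_sequence_strict(1)[OF x, of h] show ?thesis by auto
    qed auto
    then show ?thesis by (auto simp: less_SUP_iff)
  qed
  ultimately show "t \<in> - (lower_tail x \<union> upper_tail x)"
    by (auto simp: lower_tail_def upper_tail_def)
next
  fix t assume "t \<in> - (lower_tail x \<union> upper_tail x)"
  then obtain i j where i: "x i < ereal t" and j: "ereal t < x j"
    by (auto simp: lower_tail_def upper_tail_def not_le INF_less_iff less_SUP_iff)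
  have "i \<le> j"
    using point_sequence_mono[OF x, of j i] i j by (meson less_le_trans less_trans nle_le not_le)
  \<comment> \<open>The strict bound at \<open>j\<close> is relaxed because the induction stops at the first value that is
    at least \<open>t\<close>.\<close>
  then have "ereal t \<le> x j \<longrightarrow> (\<exists>h. t \<in> block x h)"
  proof (induction j rule: int_ge_induct)
    case (step k)
    then show ?case
      by (cases "x k < ereal t") (auto simp: block_def intro!: exI[of _ "k + 1"])
  qed (use i in auto)
  with j show "t \<in> (\<Union>h. block x h)"
    by auto
qed

text \<open>A common point of the tails would force the sequence to be constant with a real value.\<close>

lemma tails_disjoint:
  assumes x: "point_sequence x"
  shows "lower_tail x \<inter> upper_tail x = {}"
proof -
  have False if "ereal t \<le> (INF h. x h)" "(SUP h. x h) \<le> ereal t" for t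
  proof -
    have const: "x h = ereal t" for h
      using that by (auto simp: le_INF_iff SUP_le_iff intro: antisym)
    show False
      using point_sequence_strict(1)[OF x, of 0] by (simp add: const)
  qed
  then show ?thesis
    by (auto simp: lower_tail_def upper_tail_def)
qed

lemma sets_block [measurable]: "block x h \<in> sets borel"
  unfolding block_def by measurable

lemma sets_gap [measurable]: "gap x h \<in> sets borel"
  unfolding gap_def by measurable

lemma sets_tails [measurable]:
  "lower_tail x \<in> sets borel" "upper_tail x \<in> sets borel"
  unfolding lower_tail_def upper_tail_def by measurable

lemma block_eq_gap_Un_point:
  assumes x: "point_sequence x"
  shows "block x h = (if \<bar>x h\<bar> = \<infinity> then gap x h else insert (real_of_ereal (x h)) (gap x h))"
proof (cases "\<bar>x h\<bar> = \<infinity>")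
  case True
  then show ?thesis
    by (cases "x h") (auto simp: block_def gap_def)
next
  case False
  then have "ereal t = x h \<longleftrightarrow> t = real_of_ereal (x h)" for t
    by (cases "x h") auto
  then show ?thesis
    using False point_sequence_strict(2)[OF x False]
    by (auto simp: block_def gap_def le_less ereal_real)
qed

section \<open>The integral as the sum over the cells\<close>

lemma cell_term_eq_block_integral:
  assumes x: "point_sequence x" and f: "f \<in> borel_measurable borel"
    and mono: "\<And>s t. s \<le> t \<Longrightarrow> F s \<le> F t" and cont: "\<And>t. continuous (at_right t) F"
  shows "cell_term x F f h = LS_integral_on F (block x h) f"
proof (cases "\<bar>x h\<bar> = \<infinity>")
  case True
  then show ?thesis
    by (simp add: cell_term_def block_eq_gap_Un_point[OF x])
next
  case False
  let ?a = "real_of_ereal (x h)"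
  have f': "f \<in> borel_measurable (interval_measure F)"
    using f by (simp add: measurable_def)
  have "LS_integral_on F ({?a} \<union> gap x h) f = LS_integral_on F {?a} f + LS_integral_on F (gap x h) f"
    unfolding LS_integral_on_def
    using False by (intro ext_integral_Un[OF f']) (auto simp: gap_def ereal_real)
  also have "LS_integral_on F {?a} f = ereal (jump F ?a) * f ?a"
    unfolding LS_integral_on_def using emeasure_interval_measure_singleton[OF mono cont]
    by (intro ext_integral_singleton[OF f']) auto
  finally show ?thesis
    using False by (simp add: cell_term_def block_eq_gap_Un_point[OF x])
qed

lemma LS_integral_eq_cell_sum:
  assumes x: "point_sequence x" and f: "f \<in> borel_measurable borel"
    and mono: "\<And>s t. s \<le> t \<Longrightarrow> F s \<le> F t" and cont: "\<And>t. continuous (at_right t) F"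
    and ex: "LS_exists F f"
  shows "cell_term x F f summable_on UNIV" and "LS_integral F f = cell_sum x F f"
proof -
  let ?M = "interval_measure F" and ?B = "\<Union>h. block x h"
  have f': "f \<in> borel_measurable ?M"
    using f by (simp add: measurable_def)
  have B: "?B \<in> sets ?M"
    by (simp add: sets_block sets.countable_UN)
  have "((\<lambda>h. LS_integral_on F (block x h) f) has_sum LS_integral_on F ?B f) UNIV"
    unfolding LS_integral_on_def
    using disjoint_family_block[OF x] by (intro has_sum_ext_integral_UN[OF ex]) (auto simp: sets_block)
  moreover have "cell_term x F f = (\<lambda>h. LS_integral_on F (block x h) f)"
    using cell_term_eq_block_integral[OF x f mono cont] by (intro ext)
  ultimately have sum: "(cell_term x F f has_sum LS_integral_on F ?B f) UNIV"
    by simp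
  then show "cell_term x F f summable_on UNIV"
    by (rule has_sum_imp_summable)
  have "LS_integral F f = LS_integral_on F (?B \<union> lower_tail x \<union> upper_tail x) f"
  proof -
    have "?B \<union> lower_tail x \<union> upper_tail x = UNIV"
      using UN_block[OF x] by blast
    then show ?thesis
      by (simp add: LS_integral_on_def)
  qed
  also have "\<dots> = LS_integral_on F (?B \<union> lower_tail x) f + LS_integral_on F (upper_tail x) f"
    unfolding LS_integral_on_def using tails_disjoint[OF x] B
    by (intro ext_integral_Un[OF f']) (auto simp: sets_tails UN_block[OF x])
  also have "LS_integral_on F (?B \<union> lower_tail x) f =
      LS_integral_on F ?B f + LS_integral_on F (lower_tail x) f"
    unfolding LS_integral_on_def using B
    by (intro ext_integral_Un[OF f']) (auto simp: sets_tails UN_block[OF x])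
  finally show "LS_integral F f = cell_sum x F f"
    using infsumI[OF sum] by (simp add: cell_sum_def)
qed

lemma integral_exists_if_constant_sign:
  assumes "f \<in> borel_measurable M" and "(\<forall>t. 0 \<le> f t) \<or> (\<forall>t. f t \<le> 0)"
  shows "integral_exists M f"
proof -
  have "e2ennreal 0 = 0"
    by (simp add: e2ennreal_neg)
  with assms show ?thesis
    by (auto simp: integral_exists_def pos_part_def neg_part_def max_def cong: if_cong)
qed

lemma ext_integral_nonneg:
  assumes "\<And>t. 0 \<le> g t"
  shows "ext_integral M g = enn2ereal (\<integral>\<^sup>+ t. e2ennreal (g t) \<partial>M)"
proof -
  have "pos_part g = g" "neg_part g = (\<lambda>t. 0)"
    using assms by (auto simp: pos_part_def neg_part_def max_def fun_eq_iff intro: antisym)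
  moreover have "e2ennreal 0 = 0"
    by (simp add: e2ennreal_neg)
  ultimately show ?thesis
    by (simp add: ext_integral_def zero_ennreal.rep_eq)
qed

theorem proposition2:
  fixes x :: "int \<Rightarrow> ereal" and F :: "real \<Rightarrow> real"
  assumes x: "point_sequence x"
    and F_nonneg: "\<forall>t. 0 \<le> F t"
    and F_right_cont: "\<forall>t. continuous (at_right t) F"
    and F_length: "\<forall>a b. a < b \<longrightarrow> 0 \<le> F b - F a"
    and F_cont: "\<forall>C\<in>cells x. continuous_on C F"
    and F_discont: "\<forall>h. \<bar>x h\<bar> \<noteq> \<infinity> \<longrightarrow> \<not> isCont F (real_of_ereal (x h))"
  shows
   "(\<forall>f :: real \<Rightarrow> ereal.
        f \<in> borel_measurable borel \<longrightarrow>
        (\<forall>t. 0 \<le> f t) \<or> (\<forall>t. f t \<le> 0) \<longrightarrow>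
        (\<forall>C\<in>cells x. AE t in lborel. t \<in> C \<longrightarrow> isCont f t) \<longrightarrow>
        (\<forall>C\<in>cells x. LS_finite_on F C f) \<longrightarrow>
        LS_exists F f \<and> cell_term x F f summable_on UNIV \<and> LS_integral F f = cell_sum x F f)
    \<and>
    (\<forall>f :: real \<Rightarrow> ereal.
        f \<in> borel_measurable borel \<longrightarrow>
        (\<forall>C\<in>cells x. AE t in lborel. t \<in> C \<longrightarrow> isCont f t) \<longrightarrow>
        (\<forall>C\<in>cells x. LS_finite_on F C f) \<longrightarrow>
        (0 \<le> cell_sum x F (pos_part f) \<and> cell_sum x F (pos_part f) < \<infinity>) \<or>
        (0 \<le> cell_sum x F (neg_part f) \<and> cell_sum x F (neg_part f) < \<infinity>) \<longrightarrow>
        LS_exists F f \<and> cell_term x F f summable_on UNIV \<and> LS_integral F f = cell_sum x F f)"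
proof -
  have mono: "F s \<le> F t" if "s \<le> t" for s t
    using F_length that by (metis diff_ge_0_iff_ge le_less)
  have cont: "continuous (at_right t) F" for t
    using F_right_cont by blast
  have formula: "LS_exists F f \<and> cell_term x F f summable_on UNIV \<and> LS_integral F f = cell_sum x F f"
    if "f \<in> borel_measurable borel" "LS_exists F f" for f
    using LS_integral_eq_cell_sum[OF x that(1) mono cont that(2)] that(2) by simp
  have part: "(\<integral>\<^sup>+ t. e2ennreal (g t) \<partial>interval_measure F) < \<infinity>"
    if g: "g \<in> borel_measurable borel" "\<And>t. 0 \<le> g t" and fin: "cell_sum x F g < \<infinity>" for g
  proof -
    have "LS_exists F g"
      using g by (intro integral_exists_if_constant_sign) (auto simp: measurable_def)
    then have "LS_integral F g < \<infinity>"
      using formula[OF g(1)] fin by simp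
    then show ?thesis
      by (simp add: ext_integral_nonneg[OF g(2)] less_top)
  qed
  show ?thesis
  proof (intro conjI[of "\<forall>f. _ f"] allI impI)
    fix f :: "real \<Rightarrow> ereal"
    assume f: "f \<in> borel_measurable borel" and "(\<forall>t. 0 \<le> f t) \<or> (\<forall>t. f t \<le> 0)"
    then show "LS_exists F f \<and> cell_term x F f summable_on UNIV \<and> LS_integral F f = cell_sum x F f"
      by (intro formula integral_exists_if_constant_sign) (auto simp: measurable_def)
  next
    fix f :: "real \<Rightarrow> ereal"
    assume f [measurable]: "f \<in> borel_measurable borel"
      and sums: "(0 \<le> cell_sum x F (pos_part f) \<and> cell_sum x F (pos_part f) < \<infinity>) \<or>
        (0 \<le> cell_sum x F (neg_part f) \<and> cell_sum x F (neg_part f) < \<infinity>)"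
    have "pos_part f \<in> borel_measurable borel" "neg_part f \<in> borel_measurable borel"
      unfolding pos_part_def neg_part_def by measurable
    moreover have "0 \<le> pos_part f t" "0 \<le> neg_part f t" for t
      by (simp_all add: pos_part_def neg_part_def)
    ultimately have "LS_exists F f"
      using sums part f by (auto simp: integral_exists_def measurable_def)
    with f show "LS_exists F f \<and> cell_term x F f summable_on UNIV \<and> LS_integral F f = cell_sum x F f"
      by (rule formula)
  qed
qed

end
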